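(* If $\mathcal{C}$ is a covariety, then the graph $G(\mathcal{C})$ is a tree with root $\Delta(\mathcal{C})$.
   Context: Let $\mathbb{N}=\{0,1,2,\dots\}$. A numerical semigroup is a subset $S\subseteq\mathbb{N}$ that contains $0$, is closed under addition, and has finite complement $\mathbb{N}\setminus S$. Its multiplicity is $m(S)=\min(S\setminus\{0\})$. A covariety is a nonempty family $\mathcal{C}$ of numerical semigroups such that: (1) $\mathcal{C}$ has a minimum $\Delta(\mathcal{C})=\min(\mathcal{C})$ with respect to set inclusion; (2) if $S,T\in\mathcal{C}$ then $S\cap T\in\mathcal{C}$; (3) if $S\in\mathcal{C}$ and $S\neq\Delta(\mathcal{C})$ then $S\setminus\{m(S)\}\in\mathcal{C}$. A graph is a pair $(V,E)$ with $V$ a nonempty set (vertices) and $E\subseteq\{(u,v)\in V\times V\mid u\neq v\}$ (edges). A path of length $n$ connecting vertices $x$ and $y$ is a sequence of different edges $(v_0,v_1),(v_1,v_2),\dots,(v_{n-1},v_n)$ with $v_0=x$ and $v_n=y$. A graph is a tree with root $r$ if $r$ is a vertex such that for every other vertex $x$ there exists a unique path connecting $x$ and $r$. For a covariety $\mathcal{C}$, the graph $G(\mathcal{C})$ has vertex set $\mathcal{C}$, and $(S,T)\in\mathcal{C}\times\mathcal{C}$ is an edge if and only if $T=S\setminus\{m(S)\}$. *)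

theory Defs
  imports "Graph_Theory.Pair_Digraph"
begin

definition numerical_semigroup :: "nat set \<Rightarrow> bool" where
  "numerical_semigroup S \<longleftrightarrow>
     0 \<in> S \<and> (\<forall>x\<in>S. \<forall>y\<in>S. x + y \<in> S) \<and> finite (UNIV - S)"

(* A numerical semigroup has finite complement, so S - {0} is nonempty
   and the least element exists. *)
definition multiplicity :: "nat set \<Rightarrow> nat" where
  "multiplicity S = (LEAST n. n \<in> S - {0})"

(* The minimum is taken with respect to inclusion, the order on sets. *)
definition covariety_min :: "nat set set \<Rightarrow> nat set" where
  "covariety_min \<C> = (LEAST D. D \<in> \<C>)"

definition covariety :: "nat set set \<Rightarrow> bool" where
  "covariety \<C> \<longleftrightarrow>
     \<C> \<noteq> {} \<and>
     (\<forall>S\<in>\<C>. numerical_semigroup S) \<and>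
     (\<exists>D\<in>\<C>. \<forall>S\<in>\<C>. D \<subseteq> S) \<and>
     (\<forall>S\<in>\<C>. \<forall>T\<in>\<C>. S \<inter> T \<in> \<C>) \<and>
     (\<forall>S\<in>\<C>. S \<noteq> covariety_min \<C> \<longrightarrow> S - {multiplicity S} \<in> \<C>)"

(* Graphs are directed, possibly infinite, without loops, and have a nonempty vertex set.
   A path is a walk with pairwise different edges (vertices may repeat), which is the
   notion trail. Edges are traversed along their direction, so paths lead from x
   towards the root. *)
definition tree_with_root :: "'a pair_pre_digraph \<Rightarrow> 'a \<Rightarrow> bool" where
  "tree_with_root G r \<longleftrightarrow>
     pair_loopfree_digraph G \<and> pverts G \<noteq> {} \<and>
     r \<in> pverts G \<and>
     (\<forall>x\<in>pverts G. x \<noteq> r \<longrightarrow> (\<exists>!p. pre_digraph.trail (with_proj G) x p r))"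

definition covariety_graph :: "nat set set \<Rightarrow> nat set pair_pre_digraph" where
  "covariety_graph \<C> =
     \<lparr> pverts = \<C>,
       parcs = {(S, T). S \<in> \<C> \<and> T \<in> \<C> \<and> T = S - {multiplicity S}} \<rparr>"

end

theory Submission
  imports Defs
begin

text \<open>
  Every vertex has at most one outgoing arc and the root has none, so a walk to the root is
  determined by its starting vertex. Existence: if \<open>D\<close> is the minimum of the covariety and
  \<open>S \<noteq> D\<close>, then \<open>D \<subseteq> S - {multiplicity S}\<close>, so following arcs strictly decreases the finite
  number of elements of \<open>S - D\<close> until \<open>D\<close> is reached.
\<close>

text \<open>Single-valuedness forces two walks from the same vertex to take the same next arc, and
  neither can end at \<open>r\<close> while the other continues, since no arc leaves
  \<open>r\<close>.\<close>

lemma (in pair_wf_digraph) awalk_to_sink_unique: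
  assumes "single_valued (parcs G)" and "\<And>v. (r, v) \<notin> parcs G"
    and "awalk x p r" and "awalk x q r"
  shows "p = q"
  using assms(3,4)
proof (induction p arbitrary: x q)
  case Nil
  with assms(2) show ?case
    by (cases q) (auto simp: awalk_simps)
next
  case (Cons e p)
  \<comment> \<open>If \<open>q\<close> were empty, then \<open>x = r\<close>, and \<open>e\<close>
    would be an arc leaving \<open>r\<close>.\<close>
  with assms(2)[of "snd e"] obtain f q' where q: "q = f # q'"
    by (cases q) (auto simp: awalk_simps)
  have "fst e = fst f" "e \<in> parcs G" "f \<in> parcs G"
    using Cons.prems q by (auto simp: awalk_simps)
  then have "e = f"
    using assms(1) by (metis prod.collapse single_valuedD)
  with Cons q show ?case
    by (auto simp: awalk_simps)
qed

lemma tree_with_rootI: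
  assumes "pair_loopfree_digraph G" and "r \<in> pverts G"
    and "single_valued (parcs G)" and "\<And>v. (r, v) \<notin> parcs G"
    and "\<And>x. x \<in> pverts G \<Longrightarrow> (x, r) \<in> (parcs G)\<^sup>*"
  shows "tree_with_root G r"
proof -
  interpret pair_loopfree_digraph G by fact
  have "\<exists>!p. trail x p r" if "x \<in> pverts G" for x
  proof -
    have "\<exists>p. awalk x p r"
      using assms(5)[OF that]
    proof (induction rule: converse_rtrancl_induct)
      case base
      then show ?case
        using assms(2) awalk_Nil_iff by blast
    next
      case (step y z)
      then show ?case
        by (metis awalk_Cons_iff fst_conv snd_conv)
    qed
    \<comment> \<open>A walk may repeat arcs, which a trail must not; cutting out its cycles leaves
      distinct vertices and hence distinct arcs.\<close>
    then obtain p where "apath x p r"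
      using apath_awalk_to_apath by blast
    then have "trail x p r"
      unfolding trail_def apath_def using distinct_verts_imp_distinct by blast
    moreover have "p = q" if "trail x p r" "trail x q r" for p q
      using awalk_to_sink_unique[OF assms(3,4)] that unfolding trail_def by blast
    ultimately show ?thesis
      by blast
  qed
  then show ?thesis
    unfolding tree_with_root_def using assms(1,2) by blast
qed

text \<open>A finite complement makes \<open>S\<close> infinite, so the \<open>LEAST\<close> ranges
  over a nonempty set and is attained.\<close>

lemma multiplicity_mem:
  assumes "numerical_semigroup S"
  shows "multiplicity S \<in> S"
proof -
  have "infinite S"
    using assms infinite_UNIV_nat finite_Diff2[of S UNIV]
    unfolding numerical_semigroup_def by blast
  then have "infinite (S - {0})"
    by simp
  then have "\<exists>n. n \<in> S - {0}"
    using infinite_imp_nonempty by blast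
  from LeastI_ex[OF this] show ?thesis
    unfolding multiplicity_def by simp
qed

lemma covariety_min:
  assumes "covariety \<C>"
  shows covariety_min_mem: "covariety_min \<C> \<in> \<C>"
    and covariety_min_subset: "S \<in> \<C> \<Longrightarrow> covariety_min \<C> \<subseteq> S"
proof -
  have "\<exists>D\<in>\<C>. \<forall>S\<in>\<C>. D \<subseteq> S"
    using assms by (simp add: covariety_def)
  then obtain D where D: "D \<in> \<C>" "\<And>S. S \<in> \<C> \<Longrightarrow> D \<subseteq> S"
    by blast
  then have "covariety_min \<C> = D"
    unfolding covariety_min_def by (rule Least_equality)
  with D show "covariety_min \<C> \<in> \<C>" "S \<in> \<C> \<Longrightarrow> covariety_min \<C> \<subseteq> S"
    by auto
qed

lemma covariety_multiplicity_mem: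
  assumes "covariety \<C>" "S \<in> \<C>"
  shows "multiplicity S \<in> S"
  using assms multiplicity_mem unfolding covariety_def by blast

lemma covariety_min_reachable:
  assumes "covariety \<C>" "S \<in> \<C>"
  shows "(S, covariety_min \<C>) \<in> (parcs (covariety_graph \<C>))\<^sup>*"
  using assms(2)
proof (induction "card (S - covariety_min \<C>)" arbitrary: S rule: less_induct)
  case less
  let ?D = "covariety_min \<C>" and ?T = "S - {multiplicity S}"
  show ?case
  proof (cases "S = ?D")
    case False
    then have T: "?T \<in> \<C>"
      using assms(1) less.prems unfolding covariety_def by blast
    \<comment> \<open>As a member of the covariety, \<open>?T\<close> contains \<open>?D\<close>,
      yet it omits this element.\<close>
    then have "multiplicity S \<notin> ?D"
      using covariety_min_subset[OF assms(1)] by blast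
    then have "?T - ?D \<subset> S - ?D"
      using covariety_multiplicity_mem[OF assms(1) less.prems] by blast
    \<comment> \<open>Strict inclusion lowers the cardinality only for finite sets; here the finite
      complement of the semigroup \<open>?D\<close> is the bound.\<close>
    moreover have "finite (S - ?D)"
    proof (rule finite_subset)
      show "finite (UNIV - ?D)"
        using covariety_min_mem[OF assms(1)] assms(1)
        unfolding covariety_def numerical_semigroup_def by blast
    qed blast
    ultimately have "(?T, ?D) \<in> (parcs (covariety_graph \<C>))\<^sup>*"
      using less.hyps T psubset_card_mono by blast
    moreover have "(S, ?T) \<in> parcs (covariety_graph \<C>)"
      using less.prems T by (simp add: covariety_graph_def)
    ultimately show ?thesis
      by (rule converse_rtrancl_into_rtrancl[rotated])
  qed simp
qed

theorem proposition2p6: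
  fixes \<C> :: "nat set set"
  assumes "covariety \<C>"
  shows "tree_with_root (covariety_graph \<C>) (covariety_min \<C>)"
proof (rule tree_with_rootI)
  note mem = covariety_multiplicity_mem[OF assms]
  show "pair_loopfree_digraph (covariety_graph \<C>)"
  proof
    fix e
    assume "e \<in> parcs (covariety_graph \<C>)"
    then have arc: "fst e \<in> \<C>" "snd e \<in> \<C>" "snd e = fst e - {multiplicity (fst e)}"
      unfolding covariety_graph_def case_prod_beta pair_pre_digraph.simps by blast+
    then show "fst e \<in> pverts (covariety_graph \<C>)" "snd e \<in> pverts (covariety_graph \<C>)"
      by (simp_all add: covariety_graph_def)
    \<comment> \<open>The element removed really belongs to the source, so source and target
      differ.\<close>
    show "fst e \<noteq> snd e"
      using arc mem by blast
  qed
  show "covariety_min \<C> \<in> pverts (covariety_graph \<C>)"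
    using covariety_min_mem[OF assms] by (simp add: covariety_graph_def)
  show "single_valued (parcs (covariety_graph \<C>))"
    by (simp add: covariety_graph_def single_valued_def)
  show "(covariety_min \<C>, T) \<notin> parcs (covariety_graph \<C>)" for T
  proof
    assume "(covariety_min \<C>, T) \<in> parcs (covariety_graph \<C>)"
    then have "T \<in> \<C>" "T = covariety_min \<C> - {multiplicity (covariety_min \<C>)}"
      unfolding covariety_graph_def pair_pre_digraph.simps by blast+
    \<comment> \<open>Such a \<open>T\<close> would be a member of the covariety properly contained
      in its minimum.\<close>
    then show False
      using covariety_min_subset[OF assms] mem[OF covariety_min_mem[OF assms]] by blast
  qed
  show "(S, covariety_min \<C>) \<in> (parcs (covariety_graph \<C>))\<^sup>*"
    if "S \<in> pverts (covariety_graph \<C>)" for S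
    using covariety_min_reachable[OF assms] that by (simp add: covariety_graph_def)
qed

end
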